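(* (Pieri's formula for Schubert derivatives.) Let $k\ge1$, $h\ge0$ and $1\le i_1<i_2<\cdots<i_k$. Then in $\bigwedge^kM$ $$D_h(\epsilon^{i_1}\wedge\cdots\wedge\epsilon^{i_k})=\sum\epsilon^{j_1}\wedge\cdots\wedge\epsilon^{j_k},$$ where the sum is over all $(j_1,\ldots,j_k)$ with $i_1\le j_1<i_2\le j_2<\cdots<i_k\le j_k$ and $\sum_{p=1}^kj_p=h+\sum_{p=1}^ki_p$.
   Context: $M=\bigoplus_{i\ge1}\mathbb{Z}\epsilon^i$ is the free $\mathbb{Z}$-module with basis $(\epsilon^1,\epsilon^2,\ldots)$, and for $j\ge0$ the endomorphism $D_j$ of $M$ is given by $D_j\epsilon^i=\epsilon^{i+j}$. $D_t=\sum_{j\ge0}D_jt^j$ is extended to $D_t=\sum_{j\ge0}D_jt^j:\bigwedge M\to(\bigwedge M)[[t]]$ by requiring it to be a $\mathbb{Z}$-algebra homomorphism, i.e. $D_t(\alpha\wedge\beta)=D_t\alpha\wedge D_t\beta$; $D_h$ denotes its coefficients. *)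

theory Defs
  imports
    "HOL-Library.Poly_Mapping"
    "HOL-Computational_Algebra.Formal_Power_Series"
begin

section \<open>The free ring on a set of letters\<close>

text \<open>
  Words are wrapped in a datatype so that concatenation can be the monoid operation
  required by the convolution product on finitely supported functions.
  Thus \<open>'a fword \<Rightarrow>\<^sub>0 int\<close> is the free (noncommutative, unital) ring on \<open>'a\<close>.
\<close>

datatype 'a fword = FWord (letters: "'a list")

instantiation fword :: (type) monoid_add
begin

definition zero_fword :: "'a fword" where "0 = FWord []"

definition plus_fword :: "'a fword \<Rightarrow> 'a fword \<Rightarrow> 'a fword"
  where "v + w = FWord (letters v @ letters w)"

instance by standard (simp_all add: zero_fword_def plus_fword_def)

end

abbreviation letter :: "'a \<Rightarrow> ('a fword \<Rightarrow>\<^sub>0 int)"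
  where "letter x \<equiv> frag_of (FWord [x])"

definition free_eval :: "('a \<Rightarrow> 'r::ring_1) \<Rightarrow> ('a fword \<Rightarrow>\<^sub>0 int) \<Rightarrow> 'r"
  where "free_eval f p =
    (\<Sum>w\<in>Poly_Mapping.keys p.
       of_int (Poly_Mapping.lookup p w) * prod_list (map f (letters w)))"

lemma free_eval_superset:
  assumes "finite S" "Poly_Mapping.keys p \<subseteq> S"
  shows "free_eval f p = (\<Sum>w\<in>S. of_int (Poly_Mapping.lookup p w) * prod_list (map f (letters w)))"
  unfolding free_eval_def
  by (rule sum.mono_neutral_left) (use assms in \<open>auto simp: in_keys_iff\<close>)

lemma free_eval_diff: "free_eval f (p - q) = free_eval f p - free_eval f q"
proof -
  define S where "S = Poly_Mapping.keys p \<union> Poly_Mapping.keys q"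
  have "finite S" "Poly_Mapping.keys p \<subseteq> S" "Poly_Mapping.keys q \<subseteq> S"
    "Poly_Mapping.keys (p - q) \<subseteq> S"
    using keys_diff[of p q] by (auto simp: S_def)
  then show ?thesis
    by (simp add: free_eval_superset[of S] lookup_minus sum_subtractf left_diff_distrib)
qed

lemma free_eval_0: "free_eval f 0 = 0"
  by (simp add: free_eval_def)

lemma free_eval_add: "free_eval f (p + q) = free_eval f p + free_eval f q"
  using free_eval_diff[of f p "0 - q"] free_eval_diff[of f 0 q] by (simp add: free_eval_0)

lemma free_eval_frag_of: "free_eval f (frag_of w) = prod_list (map f (letters w))"
  by (simp add: free_eval_def)

lemma free_eval_letter: "free_eval f (letter x) = f x"
  by (simp add: free_eval_frag_of)

lemma free_eval_1: "free_eval f 1 = 1"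
  using free_eval_frag_of[of f 0] by (simp add: zero_fword_def single_one[symmetric])

lemma free_eval_mult: "free_eval f (p * q) = free_eval f p * free_eval f q"
proof -
  have base: "free_eval f (frag_of v * frag_of w) = free_eval f (frag_of v) * free_eval f (frag_of w)"
    for v w
    by (simp add: mult_single free_eval_frag_of plus_fword_def)
  have left: "free_eval f (frag_of v * q) = free_eval f (frag_of v) * free_eval f q" for v
    by (induction q rule: frag_induction[OF subset_UNIV])
      (simp_all add: base free_eval_0 free_eval_diff right_diff_distrib)
  show ?thesis
    by (induction p rule: frag_induction[OF subset_UNIV])
      (simp_all add: left free_eval_0 free_eval_diff left_diff_distrib)
qed

section \<open>The exterior algebra of an abelian group\<close>

text \<open>
  The rules \<open>additive\<close> present the tensor algebra of the \<open>\<int>\<close>-module \<open>'m\<close> (tensors are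
  \<open>\<int>\<close>-multilinear as soon as they are additive in each factor); the rule \<open>square\<close> then
  imposes \<open>m \<and> m = 0\<close>.  Each rule already contains arbitrary two-sided multiples, so the
  set is the two-sided ideal generated by these relations.
\<close>

inductive_set ext_ideal :: "('m::ab_group_add fword \<Rightarrow>\<^sub>0 int) set" where
  zero: "0 \<in> ext_ideal"
| add: "p \<in> ext_ideal \<Longrightarrow> q \<in> ext_ideal \<Longrightarrow> p + q \<in> ext_ideal"
| additive: "a * (letter (m + n) - letter m - letter n) * b \<in> ext_ideal"
| square: "a * (letter m * letter m) * b \<in> ext_ideal"

lemma ext_ideal_mult:
  assumes "p \<in> ext_ideal"
  shows "a * p * b \<in> ext_ideal"
  using assms
proof induction
  case zero
  then show ?case by (simp add: ext_ideal.zero)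
next
  case (add p q)
  have "a * (p + q) * b = a * p * b + a * q * b"
    by (simp only: distrib_left distrib_right)
  then show ?case by (simp only: ext_ideal.add[OF add.IH])
next
  case (additive c m n d)
  have "a * (c * (letter (m + n) - letter m - letter n) * d) * b
      = (a * c) * (letter (m + n) - letter m - letter n) * (d * b)"
    by (simp only: mult.assoc)
  then show ?case by (simp only: ext_ideal.additive)
next
  case (square c m d)
  have "a * (c * (letter m * letter m) * d) * b = (a * c) * (letter m * letter m) * (d * b)"
    by (simp only: mult.assoc)
  then show ?case by (simp only: ext_ideal.square)
qed

lemma ext_ideal_mult_left: "p \<in> ext_ideal \<Longrightarrow> a * p \<in> ext_ideal"
  using ext_ideal_mult[of p a 1] by simp

lemma ext_ideal_mult_right: "p \<in> ext_ideal \<Longrightarrow> p * b \<in> ext_ideal"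
  using ext_ideal_mult[of p 1 b] by simp

lemma ext_ideal_uminus: "p \<in> ext_ideal \<Longrightarrow> - p \<in> ext_ideal"
  using ext_ideal_mult_left[of p "- 1"] by simp

lemma ext_ideal_diff: "p \<in> ext_ideal \<Longrightarrow> q \<in> ext_ideal \<Longrightarrow> p - q \<in> ext_ideal"
  using ext_ideal.add[of p "- q"] ext_ideal_uminus[of q] by simp

lemma free_eval_ext_ideal:
  assumes "p \<in> ext_ideal"
    and "\<And>m n. f (m + n) = f m + f n" and "\<And>m. f m * f m = 0"
  shows "free_eval f p = 0"
  using assms(1)
  by induction
    (simp_all add: free_eval_0 free_eval_add free_eval_mult free_eval_diff free_eval_letter assms(2,3))


lemma one_notin_ext_ideal: "1 \<notin> (ext_ideal :: ('m::ab_group_add fword \<Rightarrow>\<^sub>0 int) set)"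
  using free_eval_ext_ideal[of 1 "\<lambda>_::'m. 0::int"] by (auto simp: free_eval_1)

quotient_type (overloaded) 'm exterior = "'m::ab_group_add fword \<Rightarrow>\<^sub>0 int"
  / "\<lambda>p q. p - q \<in> ext_ideal"
proof (rule equivpI)
  show "reflp (\<lambda>p q::'m fword \<Rightarrow>\<^sub>0 int. p - q \<in> ext_ideal)"
    by (simp add: reflp_def ext_ideal.zero)
  show "symp (\<lambda>p q::'m fword \<Rightarrow>\<^sub>0 int. p - q \<in> ext_ideal)"
    by (rule sympI) (metis ext_ideal_uminus minus_diff_eq)
  show "transp (\<lambda>p q::'m fword \<Rightarrow>\<^sub>0 int. p - q \<in> ext_ideal)"
  proof (rule transpI)
    fix p q r :: "'m fword \<Rightarrow>\<^sub>0 int"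
    assume "p - q \<in> ext_ideal" "q - r \<in> ext_ideal"
    then have "(p - q) + (q - r) \<in> ext_ideal" by (rule ext_ideal.add)
    then show "p - r \<in> ext_ideal" by simp
  qed
qed

text \<open>The multiplication of the ring \<open>'m exterior\<close> is the wedge product.\<close>

instantiation exterior :: (ab_group_add) ring_1
begin

lift_definition zero_exterior :: "'a exterior" is 0 .

lift_definition one_exterior :: "'a exterior" is 1 .

lift_definition plus_exterior :: "'a exterior \<Rightarrow> 'a exterior \<Rightarrow> 'a exterior" is "(+)"
  by (metis ext_ideal.add add_diff_add)

lift_definition uminus_exterior :: "'a exterior \<Rightarrow> 'a exterior" is uminus
  by (metis ext_ideal_uminus minus_diff_minus)

lift_definition minus_exterior :: "'a exterior \<Rightarrow> 'a exterior \<Rightarrow> 'a exterior" is "(-)"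
proof -
  fix p p' q q' :: "'a fword \<Rightarrow>\<^sub>0 int"
  assume "p - p' \<in> ext_ideal" "q - q' \<in> ext_ideal"
  moreover have "p - q - (p' - q') = (p - p') - (q - q')" by simp
  ultimately show "p - q - (p' - q') \<in> ext_ideal" by (simp only: ext_ideal_diff)
qed

lift_definition times_exterior :: "'a exterior \<Rightarrow> 'a exterior \<Rightarrow> 'a exterior" is "(*)"
proof -
  fix p p' q q' :: "'a fword \<Rightarrow>\<^sub>0 int"
  assume "p - p' \<in> ext_ideal" "q - q' \<in> ext_ideal"
  moreover have "p * q - p' * q' = (p - p') * q + p' * (q - q')"
    by (simp add: algebra_simps)
  ultimately show "p * q - p' * q' \<in> ext_ideal"
    by (simp add: ext_ideal.add ext_ideal_mult_left ext_ideal_mult_right)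
qed

instance
proof
  show "(0::'a exterior) \<noteq> 1"
    by transfer (use ext_ideal_uminus one_notin_ext_ideal in force)
qed (transfer; simp add: algebra_simps ext_ideal.zero)+

end

lift_definition ext_inj :: "'m::ab_group_add \<Rightarrow> 'm exterior" is letter .

lemma ext_inj_add: "ext_inj (m + n) = ext_inj m + ext_inj n"
proof transfer
  fix m n :: "'m::ab_group_add"
  show "letter (m + n) - (letter m + letter n) \<in> ext_ideal"
    using ext_ideal.additive[of 1 m n 1] by (simp add: diff_diff_eq)
qed

lemma ext_inj_square: "ext_inj m * ext_inj m = 0"
proof transfer
  fix m :: "'m::ab_group_add"
  show "letter m * letter m - 0 \<in> ext_ideal"
    using ext_ideal.square[of 1 m 1] by simp
qed

definition wedge :: "'m::ab_group_add list \<Rightarrow> 'm exterior"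
  where "wedge ms = prod_list (map ext_inj ms)"

definition is_ring_hom :: "('r::ring_1 \<Rightarrow> 's::ring_1) \<Rightarrow> bool"
  where "is_ring_hom F \<longleftrightarrow>
    F 1 = 1 \<and> (\<forall>x y. F (x + y) = F x + F y) \<and> (\<forall>x y. F (x * y) = F x * F y)"

lemma is_ring_hom_diff:
  assumes "is_ring_hom F" shows "F (x - y) = F x - F y"
  using assms unfolding is_ring_hom_def by (metis add_diff_cancel diff_add_cancel)

text \<open>The universal property of the exterior algebra.\<close>

lemma exterior_universal:
  fixes f :: "'m::ab_group_add \<Rightarrow> 'r::ring_1"
  assumes add: "\<And>m n. f (m + n) = f m + f n" and sq: "\<And>m. f m * f m = 0"
  shows "\<exists>!F. is_ring_hom F \<and> (\<forall>m. F (ext_inj m) = f m)"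
proof (rule ex_ex1I)
  define F where "F = (\<lambda>x. free_eval f (rep_exterior x))"
  have F: "F (abs_exterior p) = free_eval f p" for p
  proof -
    have "rep_exterior (abs_exterior p) - p \<in> ext_ideal"
      using Quotient3_rep_abs[OF Quotient3_exterior, of p] by (simp add: ext_ideal.zero)
    then have "free_eval f (rep_exterior (abs_exterior p) - p) = 0"
      by (rule free_eval_ext_ideal) (simp_all add: add sq)
    then show ?thesis by (simp add: F_def free_eval_diff)
  qed
  have abs: "\<exists>p. x = abs_exterior p" for x :: "'m exterior"
    by (metis Quotient3_abs_rep[OF Quotient3_exterior])
  have "is_ring_hom F"
    unfolding is_ring_hom_def
  proof (intro conjI allI)
    show "F 1 = 1" by (simp add: one_exterior_def F free_eval_1)
    fix x y :: "'m exterior"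
    obtain p q where "x = abs_exterior p" "y = abs_exterior q" using abs by meson
    then show "F (x + y) = F x + F y" "F (x * y) = F x * F y"
      by (simp_all add: plus_exterior.abs_eq times_exterior.abs_eq F free_eval_add free_eval_mult)
  qed
  moreover have "F (ext_inj m) = f m" for m
    by (simp add: ext_inj_def F free_eval_letter)
  ultimately show "\<exists>F. is_ring_hom F \<and> (\<forall>m. F (ext_inj m) = f m)" by blast
next
  fix F G :: "'m exterior \<Rightarrow> 'r"
  assume F: "is_ring_hom F \<and> (\<forall>m. F (ext_inj m) = f m)"
    and G: "is_ring_hom G \<and> (\<forall>m. G (ext_inj m) = f m)"
  have word: "F (abs_exterior (frag_of (FWord ms))) = G (abs_exterior (frag_of (FWord ms)))" for ms
  proof (induction ms)
    case Nil
    have "abs_exterior (frag_of (FWord [])) = (1 :: 'm exterior)"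
      by (simp add: one_exterior_def single_one[symmetric] zero_fword_def)
    then show ?case using F G by (simp add: is_ring_hom_def)
  next
    case (Cons m ms)
    have "frag_of (FWord (m # ms)) = letter m * frag_of (FWord ms)"
      by (simp add: mult_single plus_fword_def)
    then have "abs_exterior (frag_of (FWord (m # ms))) = ext_inj m * abs_exterior (frag_of (FWord ms))"
      by (simp add: times_exterior.abs_eq ext_inj_def)
    then show ?case using F G Cons.IH by (simp add: is_ring_hom_def)
  qed
  have "F (abs_exterior p) = G (abs_exterior p)" for p
  proof (induction p rule: frag_induction[OF subset_UNIV])
    case 1
    have "abs_exterior 0 = (0 :: 'm exterior)" by (simp add: zero_exterior_def)
    then show ?case
      using is_ring_hom_diff[of F 0 0] is_ring_hom_diff[of G 0 0] F G by simp
  next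
    case (2 w)
    then show ?case using word[of "letters w"] by simp
  next
    case (3 a b)
    then show ?case using F G by (simp add: minus_exterior.abs_eq[symmetric] is_ring_hom_diff)
  qed
  then show "F = G"
    by (metis ext Quotient3_abs_rep[OF Quotient3_exterior])
qed

section \<open>The module \<open>M\<close> and its Schubert derivatives\<close>

typedef posnat = "{n::nat. 1 \<le> n}" by auto

type_synonym zmod = "posnat \<Rightarrow>\<^sub>0 int"

text \<open>The value of \<open>eps i\<close> is meaningful only for \<open>1 \<le> i\<close>.\<close>

definition eps :: "nat \<Rightarrow> zmod"
  where "eps i = frag_of (Abs_posnat i)"

definition shift :: "nat \<Rightarrow> zmod \<Rightarrow> zmod"
  where "shift j = frag_extend (\<lambda>i. eps (Rep_posnat i + j))"

lemma shift_eps: "1 \<le> i \<Longrightarrow> shift j (eps i) = eps (i + j)"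
  by (simp add: shift_def eps_def Abs_posnat_inverse)

lemma shift_add: "shift j (m + n) = shift j m + shift j n"
  by (simp add: shift_def frag_extend_add)

definition schubert_series :: "zmod exterior \<Rightarrow> zmod exterior fps"
  where "schubert_series = (THE F. is_ring_hom F \<and>
    (\<forall>m. F (ext_inj m) = Abs_fps (\<lambda>j. ext_inj (shift j m))))"

definition schubert_deriv :: "nat \<Rightarrow> zmod exterior \<Rightarrow> zmod exterior"
  where "schubert_deriv h \<alpha> = fps_nth (schubert_series \<alpha>) h"

lemma ext_inj_anticomm: "ext_inj m * ext_inj n = - (ext_inj n * ext_inj m)"
  using ext_inj_square[of "m + n"]
  by (simp add: ext_inj_add ext_inj_square distrib_left distrib_right add_eq_0_iff2 add.commute)

lemma alternating_convolution_0:
  fixes a :: "nat \<Rightarrow> 'm::ab_group_add"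
  shows "(\<Sum>i=0..n. ext_inj (a i) * ext_inj (a (n - i))) = 0"
proof -
  have "(\<Sum>i\<in>A. \<Sum>j\<in>A. if i + j = n then ext_inj (a i) * ext_inj (a j) else 0) = 0"
    if "finite A" for A
    using that
  proof induction
    case (insert x A)
    have "(\<Sum>i\<in>A. if i + x = n then ext_inj (a i) * ext_inj (a x) else 0)
        = - (\<Sum>j\<in>A. if x + j = n then ext_inj (a x) * ext_inj (a j) else 0)"
      unfolding sum_negf[symmetric]
      by (rule sum.cong) (auto simp: add.commute ext_inj_anticomm[of "a x"])
    then show ?case
      using insert by (simp add: sum.distrib ext_inj_square)
  qed simp
  from this[of "{0..n}"] have
    "(\<Sum>i=0..n. \<Sum>j=0..n. if i + j = n then ext_inj (a i) * ext_inj (a j) else 0) = 0"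
    by simp
  moreover have "(\<Sum>j=0..n. if i + j = n then ext_inj (a i) * ext_inj (a j) else 0)
      = ext_inj (a i) * ext_inj (a (n - i))" if "i \<in> {0..n}" for i
  proof -
    have "(i + j = n) = (j = n - i)" for j using that by auto
    then show ?thesis by (simp add: sum.delta)
  qed
  ultimately show ?thesis by simp
qed

lemma schubert_series_ex1:
  "\<exists>!F. is_ring_hom F \<and> (\<forall>m::zmod. F (ext_inj m) = Abs_fps (\<lambda>j. ext_inj (shift j m)))"
proof (rule exterior_universal)
  show "Abs_fps (\<lambda>j. ext_inj (shift j (m + n)))
      = Abs_fps (\<lambda>j. ext_inj (shift j m)) + Abs_fps (\<lambda>j. ext_inj (shift j n))" for m n
    by (simp add: fps_eq_iff shift_add ext_inj_add)
  show "Abs_fps (\<lambda>j. ext_inj (shift j m)) * Abs_fps (\<lambda>j. ext_inj (shift j m)) = 0" for m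
    using alternating_convolution_0[of "\<lambda>j. shift j m"]
    by (simp add: fps_eq_iff fps_mult_nth)
qed

lemma
  shows is_ring_hom_schubert_series: "is_ring_hom schubert_series"
    and schubert_series_ext_inj:
      "schubert_series (ext_inj m) = Abs_fps (\<lambda>j. ext_inj (shift j m))"
  using theI'[OF schubert_series_ex1] unfolding schubert_series_def by blast+

lemma schubert_deriv_ext_inj: "schubert_deriv j (ext_inj m) = ext_inj (shift j m)"
  by (simp add: schubert_deriv_def schubert_series_ext_inj)

section \<open>The index set of Pieri's formula\<close>

text \<open>Tuples are lists, with positions counted from 0.\<close>

definition pieri_tuples :: "nat \<Rightarrow> nat list \<Rightarrow> nat list set"
  where "pieri_tuples h is = {js. length js = length is \<and>
    (\<forall>p < length is. is ! p \<le> js ! p) \<and>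
    (\<forall>p. Suc p < length is \<longrightarrow> js ! p < is ! Suc p) \<and>
    sum_list js = h + sum_list is}"

lemma finite_pieri_tuples: "finite (pieri_tuples h is)"
proof (rule finite_subset)
  show "pieri_tuples h is \<subseteq> {js. set js \<subseteq> {..h + sum_list is} \<and> length js = length is}"
    unfolding pieri_tuples_def using member_le_sum_list by fastforce
  show "finite {js. set js \<subseteq> {..h + sum_list is} \<and> length js = length is}"
    by (rule finite_lists_length_eq) simp
qed

end

theory Submission
  imports Defs
begin

text \<open>
  Write \<open>E\<^sub>a = \<Sum>\<^sub>j \<epsilon>\<^sup>a\<^sup>+\<^sup>j t\<^sup>j\<close> for the series that \<open>D\<^sub>t\<close> assigns to \<open>\<epsilon>\<^sup>a\<close>.
  For \<open>a < b\<close> the terms of \<open>E\<^sub>a\<close> from \<open>\<epsilon>\<^sup>b\<close> on form the series \<open>t\<^sup>b\<^sup>-\<^sup>a E\<^sub>b\<close>, and this tail is killed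
  by a following factor \<open>E\<^sub>b\<close>, because \<open>E\<^sub>b E\<^sub>b = D\<^sub>t (\<epsilon>\<^sup>b \<and> \<epsilon>\<^sup>b) = 0\<close>.
  Hence in \<open>D\<^sub>t (\<epsilon>\<^sup>a \<and> \<epsilon>\<^sup>b \<and> \<dots>) = E\<^sub>a E\<^sub>b \<cdots>\<close> the first factor may be replaced by the polynomial
  \<open>\<Sum>\<^sub>j \<epsilon>\<^sup>a\<^sup>+\<^sup>j t\<^sup>j\<close> over \<open>a + j < b\<close> (\<open>schubert_series_eps_mult_eps\<close>).  This truncation is precisely
  the interlacing condition \<open>i\<^sub>1 \<le> j\<^sub>1 < i\<^sub>2\<close>, so the recursion obtained by comparing coefficients
  (\<open>schubert_deriv_wedge_Cons_Cons\<close>) is the one satisfied by the index sets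
  (\<open>pieri_tuples_Cons_Cons\<close>).  No cancellation among wedge products has to be tracked.
\<close>

lemma wedge_Nil: "wedge [] = 1"
  and wedge_Cons: "wedge (m # ms) = ext_inj m * wedge ms"
  by (simp_all add: wedge_def)

lemma schubert_series_mult:
  "schubert_series (\<alpha> * \<beta>) = schubert_series \<alpha> * schubert_series \<beta>"
  using is_ring_hom_schubert_series by (simp add: is_ring_hom_def)

lemma schubert_series_ext_inj_square:
  "schubert_series (ext_inj m) * schubert_series (ext_inj m) = 0"
  using is_ring_hom_diff[OF is_ring_hom_schubert_series, of 0 0]
  by (simp add: schubert_series_mult[symmetric] ext_inj_square)

lemma schubert_series_eps_nth:
  "1 \<le> a \<Longrightarrow> fps_nth (schubert_series (ext_inj (eps a))) j = ext_inj (eps (a + j))"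
  by (simp add: schubert_series_ext_inj shift_eps)

text \<open>
  The coefficients of \<open>D\<^sub>t \<epsilon>\<^sup>a\<close> at \<open>\<epsilon>\<^sup>b\<close> and beyond are those of \<open>D\<^sub>t \<epsilon>\<^sup>b\<close>, delayed by \<open>b - a\<close> steps.
\<close>

lemma schubert_series_eps_split:
  assumes "1 \<le> a" and "a \<le> b"
  shows "schubert_series (ext_inj (eps a)) =
    fps_cutoff (b - a) (schubert_series (ext_inj (eps a)))
      + fps_X ^ (b - a) * schubert_series (ext_inj (eps b))"
  using assms by (auto simp: fps_eq_iff fps_X_power_mult_nth schubert_series_eps_nth add.commute)

lemma schubert_series_eps_mult_eps:
  assumes "1 \<le> a" and "a \<le> b"
  shows "schubert_series (ext_inj (eps a)) * schubert_series (ext_inj (eps b)) =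
    fps_cutoff (b - a) (schubert_series (ext_inj (eps a))) * schubert_series (ext_inj (eps b))"
  by (subst schubert_series_eps_split[OF assms])
    (simp add: distrib_right mult.assoc schubert_series_ext_inj_square)

lemma schubert_deriv_wedge_Cons_Cons:
  assumes "1 \<le> a" and "a < b"
  shows "schubert_deriv h (wedge (eps a # eps b # ms)) =
    (\<Sum>j | j \<le> h \<and> a + j < b.
      ext_inj (eps (a + j)) * schubert_deriv (h - j) (wedge (eps b # ms)))"
proof -
  let ?E = "\<lambda>i. schubert_series (ext_inj (eps i))"
  have "schubert_series (wedge (eps a # eps b # ms)) = (?E a * ?E b) * schubert_series (wedge ms)"
    by (simp add: wedge_Cons schubert_series_mult mult.assoc)
  also have "\<dots> = fps_cutoff (b - a) (?E a) * schubert_series (wedge (eps b # ms))"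
    using assms by (simp add: schubert_series_eps_mult_eps wedge_Cons schubert_series_mult mult.assoc)
  finally have "schubert_deriv h (wedge (eps a # eps b # ms)) =
      (\<Sum>j=0..h. fps_nth (fps_cutoff (b - a) (?E a)) j * schubert_deriv (h - j) (wedge (eps b # ms)))"
    by (simp add: schubert_deriv_def fps_mult_nth)
  also have "\<dots> = (\<Sum>j | j \<le> h \<and> a + j < b.
      ext_inj (eps (a + j)) * schubert_deriv (h - j) (wedge (eps b # ms)))"
    using assms by (intro sum.mono_neutral_cong_right) (auto simp: schubert_series_eps_nth)
  finally show ?thesis .
qed

lemma pieri_tuples_singleton: "pieri_tuples h [a] = {[a + h]}"
  by (auto simp: pieri_tuples_def length_Suc_conv)

text \<open>
  Here \<open>j\<close> is the part of \<open>h\<close> used up by the first entry.  Only its upper bound \<open>b\<close> couples the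
  first entry to the remaining ones.
\<close>

lemma pieri_tuples_Cons_Cons:
  "pieri_tuples h (a # b # is) =
    (\<Union>j\<in>{j. j \<le> h \<and> a + j < b}. (#) (a + j) ` pieri_tuples (h - j) (b # is))"
proof (intro equalityI subsetI)
  fix js
  assume js: "js \<in> pieri_tuples h (a # b # is)"
  then obtain c ks where [simp]: "js = c # ks"
    by (auto simp: pieri_tuples_def length_Suc_conv)
  have len: "length ks = Suc (length is)"
    and low: "\<And>p. p < Suc (Suc (length is)) \<Longrightarrow> (a # b # is) ! p \<le> (c # ks) ! p"
    and up: "\<And>p. p < Suc (length is) \<Longrightarrow> (c # ks) ! p < (b # is) ! p"
    and sum: "c + sum_list ks = h + (a + (b + sum_list is))"
    using js by (auto simp: pieri_tuples_def)
  have low': "\<And>p. p < Suc (length is) \<Longrightarrow> (b # is) ! p \<le> ks ! p"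
    using low[of "Suc _"] by simp
  have up': "\<And>p. p < length is \<Longrightarrow> ks ! p < is ! p"
    using up[of "Suc _"] by simp
  have c: "a \<le> c" "c < b"
    using low[of 0] up[of 0] by simp_all
  \<comment> \<open>The remaining entries dominate theirs termwise, so the first entry uses at most \<open>h\<close>.\<close>
  have "sum_list (b # is) \<le> sum_list ks"
    using len low' by (intro sum_list_mono2) auto
  then have "ks \<in> pieri_tuples (h - (c - a)) (b # is)" "c - a \<le> h"
    using len low' up' sum c by (auto simp: pieri_tuples_def)
  then show "js \<in> (\<Union>j\<in>{j. j \<le> h \<and> a + j < b}. (#) (a + j) ` pieri_tuples (h - j) (b # is))"
    using c by (intro UN_I[of "c - a"]) auto
next
  fix js
  assume "js \<in> (\<Union>j\<in>{j. j \<le> h \<and> a + j < b}. (#) (a + j) ` pieri_tuples (h - j) (b # is))"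
  then show "js \<in> pieri_tuples h (a # b # is)"
    by (auto simp: pieri_tuples_def nth_Cons split: nat.splits)
qed

lemma sum_pieri_tuples_Cons_Cons:
  fixes f :: "nat list \<Rightarrow> 'a::comm_monoid_add"
  shows "sum f (pieri_tuples h (a # b # is)) =
    (\<Sum>j | j \<le> h \<and> a + j < b. \<Sum>ks\<in>pieri_tuples (h - j) (b # is). f ((a + j) # ks))"
proof -
  have "finite {j. j \<le> h \<and> a + j < b}" by simp
  then show ?thesis
    unfolding pieri_tuples_Cons_Cons
    by (subst sum.UNION_disjoint) (auto simp: finite_pieri_tuples sum.reindex)
qed

theorem proposition3p7:
  fixes k h :: nat and "is" :: "nat list"
  assumes "1 \<le> k" and "length is = k"
    and "\<forall>i \<in> set is. 1 \<le> i" and "sorted_wrt (<) is"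
  shows "schubert_deriv h (wedge (map eps is)) =
    (\<Sum>js \<in> pieri_tuples h is. wedge (map eps js))"
proof -
  have "is \<noteq> []"
    using assms(1,2) by auto
  then show ?thesis
    using assms(3,4)
  proof (induction "is" arbitrary: h rule: list_nonempty_induct)
    case (single a)
    then show ?case
      by (simp add: wedge_Cons wedge_Nil schubert_deriv_ext_inj shift_eps pieri_tuples_singleton)
  next
    case (cons a bs)
    then obtain b cs where bs: "bs = b # cs"
      by (cases bs) auto
    have "schubert_deriv h (wedge (map eps (a # bs))) =
        (\<Sum>j | j \<le> h \<and> a + j < b. ext_inj (eps (a + j)) * schubert_deriv (h - j) (wedge (map eps bs)))"
      using cons.prems by (simp add: bs schubert_deriv_wedge_Cons_Cons)
    also have "\<dots> = (\<Sum>j | j \<le> h \<and> a + j < b.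
        \<Sum>ks\<in>pieri_tuples (h - j) bs. wedge (map eps ((a + j) # ks)))"
      using cons.prems by (simp add: cons.IH sum_distrib_left wedge_Cons)
    also have "\<dots> = (\<Sum>js\<in>pieri_tuples h (a # bs). wedge (map eps js))"
      by (simp add: bs sum_pieri_tuples_Cons_Cons)
    finally show ?case .
  qed
qed

end
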